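(* Let $N\ge1$, $1<p<\infty$ and $0<s<1$, and let $\Omega\subset\mathbb{R}^N$ be a bounded Lipschitz domain. Then there exists a constant $C=C(N,s,p,\Omega)>0$ such that, for every $u\in W^{s+\log,p}_0(\Omega)$, $$\int_\Omega\frac{|u(x)|^p}{d(x)^{sp}}\left(\ln\Big(\frac1{d(x)}\Big)\right)_+dx\le C\iint_{\mathbb{R}^{2N}}|u(x)-u(y)|^p\,\mathbf{k}^{s+\log,+}_p(x-y)\,dx\,dy.$$
   Context: $d(x)=\inf_{y\in\partial\Omega}|x-y|$ for $x\in\Omega$; $(a)_+=\max\{0,a\}$; $$\mathbf{k}^{s+\log,+}_p(z)=\frac{C(N,s,p)(-\ln|z|)_+}{|z|^{N+sp}},\quad z\in\mathbb{R}^N\setminus\{0\},$$ $$C(N,s,p)=\begin{cases}\dfrac{s\,p\,2^{2(s-1)}\,\Gamma\left(\frac{N+sp}{2}\right)}{\pi^{\frac{N-1}{2}}\,\Gamma(1-s)\,\Gamma\left(\frac{p+1}{2}\right)}, & s>\tfrac12,\\[8pt]\dfrac{s\,p\,2^{2s-1}\,\Gamma\left(\frac{N+sp}{2}\right)}{\pi^{\frac N2}\,\Gamma(1-s)}, & s\le\tfrac12.\end{cases}$$ $W^{s+\log,p}_0(\Omega)$ is the space of real-valued $u\in L^p(\mathbb{R}^N)$ with $u=0$ a.e. in $\mathbb{R}^N\setminus\Omega$ and $\iint_{\mathbb{R}^{2N}}|u(x)-u(y)|^p\,\mathbf{k}^{s+\log,+}_p(x-y)\,dx\,dy<\infty$.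 *)

theory Defs
  imports "HOL-Analysis.Analysis"
begin

definition kernel_const :: "nat \<Rightarrow> real \<Rightarrow> real \<Rightarrow> real" where
  "kernel_const N s p =
    (if s > 1/2 then
       s * p * 2 powr (2 * (s - 1)) * Gamma ((real N + s * p) / 2)
         / (pi powr ((real N - 1) / 2) * Gamma (1 - s) * Gamma ((p + 1) / 2))
     else
       s * p * 2 powr (2 * s - 1) * Gamma ((real N + s * p) / 2)
         / (pi powr (real N / 2) * Gamma (1 - s)))"

text \<open>The kernel is only meant for \<open>z \<noteq> 0\<close>; at \<open>z = 0\<close> the conventions \<open>ln 0 = 0\<close> and
  \<open>x / 0 = 0\<close> give it the value \<open>0\<close>.\<close>

definition log_kernel :: "real \<Rightarrow> real \<Rightarrow> 'a::euclidean_space \<Rightarrow> real" where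
  "log_kernel s p z =
    kernel_const DIM('a) s p * max 0 (- ln (norm z)) / norm z powr (real DIM('a) + s * p)"

definition log_energy :: "real \<Rightarrow> real \<Rightarrow> ('a::euclidean_space \<Rightarrow> real) \<Rightarrow> ennreal" where
  "log_energy s p u =
    (\<integral>\<^sup>+ (x, y). ennreal (\<bar>u x - u y\<bar> powr p * log_kernel s p (x - y))
       \<partial>(lebesgue \<Otimes>\<^sub>M lebesgue))"

text \<open>Elements are functions rather than classes modulo null sets; membership and
  \<open>log_energy\<close> are invariant under changes of \<open>u\<close> on a null set.\<close>

definition log_sobolev0 ::
    "real \<Rightarrow> real \<Rightarrow> 'a::euclidean_space set \<Rightarrow> ('a \<Rightarrow> real) set" where
  "log_sobolev0 s p \<Omega> =
    {u. u \<in> borel_measurable lebesgue \<and>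
        integrable lebesgue (\<lambda>x. \<bar>u x\<bar> powr p) \<and>
        (AE x in lebesgue. x \<notin> \<Omega> \<longrightarrow> u x = 0) \<and>
        log_energy s p u < \<infinity>}"

text \<open>Near each boundary point the set is the strict epigraph of a Lipschitz function after a
  rigid change of coordinates. The unit vector \<open>e\<close> is the new vertical axis, and
  \<open>x - (x \<bullet> e) *\<^sub>R e\<close> is the projection of \<open>x\<close> to the hyperplane orthogonal to \<open>e\<close>, which plays
  the role of \<open>\<real>\<^sup>N\<^sup>-\<^sup>1\<close>; values of \<open>\<gamma>\<close> off that hyperplane are irrelevant.\<close>

definition lipschitz_boundary :: "'a::euclidean_space set \<Rightarrow> bool" where
  "lipschitz_boundary \<Omega> \<longleftrightarrow>
    (\<forall>z \<in> frontier \<Omega>. \<exists>r > 0. \<exists>e. \<exists>L. \<exists>\<gamma> :: 'a \<Rightarrow> real.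
       norm e = 1 \<and> L-lipschitz_on {y. y \<bullet> e = 0} \<gamma> \<and>
       \<Omega> \<inter> ball z r = {x \<in> ball z r. \<gamma> (x - (x \<bullet> e) *\<^sub>R e) < x \<bullet> e})"

definition bounded_lipschitz_domain :: "'a::euclidean_space set \<Rightarrow> bool" where
  "bounded_lipschitz_domain \<Omega> \<longleftrightarrow>
    open \<Omega> \<and> connected \<Omega> \<and> \<Omega> \<noteq> {} \<and> bounded \<Omega> \<and> lipschitz_boundary \<Omega>"

end

theory Submission
  imports Defs
begin

text \<open>
  Write \<open>k\<close> for the kernel, \<open>d x\<close> for the distance of \<open>x\<close> to the boundary, and \<open>w d\<close> for
  \<open>ln (1/d)\<^sub>+ / d\<^sup>s\<^sup>p\<close>. Since \<open>u\<close> vanishes off \<open>\<Omega>\<close>, restricting the energy to pairs with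
  \<open>x \<in> \<Omega>\<close> and \<open>y \<notin> \<Omega>\<close> gives
  \<open>\<integral>\<^sub>\<Omega> \<bar>u x\<bar>\<^sup>p (\<integral>\<^bsub>y \<notin> \<Omega>\<^esub> k (x - y) dy) dx\<close> as a lower bound. Near the boundary the claim
  is therefore pointwise and about \<open>\<Omega>\<close> alone: the kernel mass which \<open>x\<close> sees outside \<open>\<Omega>\<close>
  dominates \<open>w (d x)\<close>. It does, because below a Lipschitz graph there is, within distance
  \<open>3 d\<close> of \<open>x\<close>, a ball of radius \<open>\<delta> d\<close> in the complement of \<open>\<Omega>\<close>
  (\<open>lipschitz_boundary_exterior_ball\<close>), on which \<open>k (x - y)\<close> is at least a multiple of
  \<open>ln (1/(3 d)) / d\<^sup>N\<^sup>+\<^sup>s\<^sup>p\<close>, and \<open>ln (1/(3 d))\<close> is comparable to \<open>ln (1/d)\<close> for small \<open>d\<close>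
  (\<open>hardy_weight_le_exterior_kernel_mass\<close>).

  Away from the boundary the weight is bounded, and what remains is a Poincare inequality
  (\<open>borel_energy_poincare\<close>). The kernel has range one, so a large \<open>\<Omega>\<close> cannot be left in a single
  jump; but \<open>n\<close> equal jumps \<open>h\<close> with \<open>\<bar>h\<bar> \<ge> 1/4\<close> and \<open>n\<close> large do leave it, and telescoping
  \<open>u x = u x - u (x + n h)\<close> bounds the \<open>L\<^sup>p\<close> norm of \<open>u\<close> by that of \<open>u - u (\<sqdot> + h)\<close>. Averaging
  over a ball of such \<open>h\<close>, on which \<open>k\<close> is bounded below, recovers the energy.

  Both estimates use Tonelli and translation invariance, so \<open>u\<close> is first replaced by a Borel
  function that vanishes at every point off \<open>\<Omega>\<close>; this changes neither side.
\<close>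

section \<open>The kernel\<close>

lemma kernel_const_pos:
  assumes "0 < p" "0 < s" "s < 1"
  shows "0 < kernel_const N s p"
  using assms unfolding kernel_const_def
  by (auto intro!: divide_pos_pos mult_pos_pos Gamma_real_pos add_nonneg_pos)

lemma log_kernel_nonneg:
  assumes "0 < p" "0 < s" "s < 1"
  shows "0 \<le> log_kernel s p z"
  unfolding log_kernel_def
  by (intro divide_nonneg_nonneg mult_nonneg_nonneg less_imp_le[OF kernel_const_pos[OF assms]]) auto

lemma log_kernel_minus: "log_kernel s p (- z) = log_kernel s p z"
  by (simp add: log_kernel_def)

lemma log_kernel_measurable [measurable]: "log_kernel s p \<in> borel_measurable borel"
  unfolding log_kernel_def [abs_def] by measurable

text \<open>As the radius grows, the numerator decreases and the denominator increases.\<close>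

lemma log_kernel_ge:
  fixes z :: "'a::euclidean_space"
  assumes "0 < p" "0 < s" "s < 1" and z: "z \<noteq> 0" "norm z \<le> r"
  shows "kernel_const DIM('a) s p * max 0 (- ln r) / r powr (real DIM('a) + s * p) \<le> log_kernel s p z"
proof -
  have "0 < norm z" using z by simp
  then have "ln (norm z) \<le> ln r" using z by (subst ln_le_cancel_iff) linarith+
  then show ?thesis
    unfolding log_kernel_def using kernel_const_pos[OF assms(1-3), of "DIM('a)"] assms z
    by (intro frac_le mult_left_mono powr_mono2 mult_nonneg_nonneg) (auto simp: add_nonneg_nonneg)
qed

section \<open>The energy of a Borel representative\<close>

definition borel_energy :: "real \<Rightarrow> real \<Rightarrow> ('a::euclidean_space \<Rightarrow> real) \<Rightarrow> ennreal" where
  "borel_energy s p v =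
    (\<integral>\<^sup>+ x. \<integral>\<^sup>+ y. ennreal (\<bar>v x - v y\<bar> powr p * log_kernel s p (x - y)) \<partial>lborel \<partial>lborel)"

lemma sigma_finite_completion:
  assumes "sigma_finite_measure M"
  shows "sigma_finite_measure (completion M)"
proof
  obtain A where A: "countable A" "A \<subseteq> sets M" "\<Union>A = space M" "\<forall>a\<in>A. emeasure M a \<noteq> \<infinity>"
    using assms unfolding sigma_finite_measure_def by blast
  then show "\<exists>A. countable A \<and> A \<subseteq> sets (completion M) \<and> \<Union> A = space (completion M)
      \<and> (\<forall>a\<in>A. emeasure (completion M) a \<noteq> \<infinity>)"
    by (intro exI[of _ A]) (auto simp: subset_iff)
qed

text \<open>Each inner and then the outer integral of the Tonelli form ignores null sets, so the energy
  does not see the change of representative, nor the completion of Lebesgue measure.\<close>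

lemma log_energy_eq_borel_energy:
  fixes u v :: "'a::euclidean_space \<Rightarrow> real"
  assumes u [measurable]: "u \<in> borel_measurable lebesgue"
    and ae: "AE x in lborel. u x = v x"
  shows "log_energy s p u = borel_energy s p v"
proof -
  interpret L: sigma_finite_measure "lebesgue :: 'a measure"
    by (rule sigma_finite_completion) (rule sigma_finite_lborel)
  have id_lebesgue: "(\<lambda>x. x) \<in> measurable (lebesgue :: 'a measure) borel"
    by (simp add: measurable_completion)
  have "(\<lambda>q. fst q - snd q) \<in> borel_measurable (lebesgue \<Otimes>\<^sub>M (lebesgue :: 'a measure))"
    by (intro borel_measurable_diff measurable_compose[OF measurable_fst id_lebesgue]
        measurable_compose[OF measurable_snd id_lebesgue])
  then have [measurable]: "(\<lambda>q. log_kernel s p (fst q - snd q))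
      \<in> borel_measurable (lebesgue \<Otimes>\<^sub>M (lebesgue :: 'a measure))"
    by (rule measurable_compose[OF _ log_kernel_measurable])
  have [measurable]: "(\<lambda>(x, y). ennreal (\<bar>u x - u y\<bar> powr p * log_kernel s p (x - y)))
      \<in> borel_measurable (lebesgue \<Otimes>\<^sub>M (lebesgue :: 'a measure))"
    unfolding split_beta by measurable
  have "log_energy s p u =
      (\<integral>\<^sup>+ x. \<integral>\<^sup>+ y. ennreal (\<bar>u x - u y\<bar> powr p * log_kernel s p (x - y)) \<partial>lebesgue \<partial>lebesgue)"
    unfolding log_energy_def by (subst L.nn_integral_fst[symmetric]) auto
  also have "\<dots> = borel_energy s p v"
    unfolding borel_energy_def nn_integral_completion
  proof (rule nn_integral_cong_AE, use ae in eventually_elim)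
    case (elim x)
    show ?case
      by (rule nn_integral_cong_AE, use ae in eventually_elim) (simp add: elim)
  qed
  finally show ?thesis .
qed

section \<open>The exterior of a Lipschitz domain near its boundary\<close>

text \<open>Moving from a boundary point \<open>z\<close> down by \<open>t\<close> along the axis \<open>e\<close> leaves a gap of height \<open>t\<close>
  below the graph. Moving within radius \<open>\<delta> t\<close> closes at most \<open>\<delta> t\<close> of it by rising
  and \<open>L \<delta> t\<close> by the variation of the graph, hence \<open>\<delta> = 1 / (1 + L)\<close>.\<close>

lemma lipschitz_boundary_exterior_ball_local:
  fixes \<Omega> :: "'a::euclidean_space set"
  assumes "open \<Omega>" "lipschitz_boundary \<Omega>" and z0: "z0 \<in> frontier \<Omega>"
  shows "\<exists>\<tau>>0. \<exists>\<delta>>0. \<forall>z\<in>frontier \<Omega> \<inter> ball z0 \<tau>. \<forall>t. 0 < t \<and> t \<le> \<tau> \<longrightarrow>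
    (\<exists>w. ball w (\<delta> * t) \<subseteq> ball z (2 * t) - \<Omega>)"
proof -
  obtain r e L and \<gamma> :: "'a \<Rightarrow> real" where r: "r > 0" and e: "norm e = 1"
    and L: "L-lipschitz_on {y. y \<bullet> e = 0} \<gamma>"
    and graph: "\<Omega> \<inter> ball z0 r = {x \<in> ball z0 r. \<gamma> (x - (x \<bullet> e) *\<^sub>R e) < x \<bullet> e}"
    using assms unfolding lipschitz_boundary_def by meson
  have L0: "0 \<le> L" using L by (rule lipschitz_on_nonneg)
  have ee: "e \<bullet> e = 1" using e by (simp add: norm_eq_1)
  define P where "P = (\<lambda>x::'a. x - (x \<bullet> e) *\<^sub>R e)"
  define \<delta> where "\<delta> = 1 / (1 + L)"
  have \<delta>: "0 < \<delta>" "\<delta> \<le> 1" "\<delta> + L * \<delta> = 1"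
    using L0 by (auto simp: \<delta>_def field_simps)
  have P_orth: "P x \<bullet> e = 0" for x
    by (simp add: P_def inner_diff_left ee)
  have P_contr: "dist (P x) (P y) \<le> dist x y" for x y
  proof -
    have "P x - P y = (x - y) - ((x - y) \<bullet> e) *\<^sub>R e"
      by (simp add: P_def inner_diff_left algebra_simps)
    moreover have "(norm ((x - y) - ((x - y) \<bullet> e) *\<^sub>R e))\<^sup>2 = (norm (x - y))\<^sup>2 - ((x - y) \<bullet> e)\<^sup>2"
      unfolding power2_norm_eq_inner
      by (simp add: inner_diff_left inner_diff_right ee inner_commute power2_eq_square algebra_simps)
    ultimately have "(norm (P x - P y))\<^sup>2 \<le> (norm (x - y))\<^sup>2" by simp
    then show ?thesis unfolding dist_norm by (rule power2_le_imp_le) simp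
  qed
  have "\<exists>w. ball w (\<delta> * t) \<subseteq> ball z (2 * t) - \<Omega>"
    if z: "z \<in> frontier \<Omega>" "dist z0 z < r / 4" and t: "0 < t" "t \<le> r / 4" for z t
  proof (intro exI subsetI)
    fix y assume "y \<in> ball (z - t *\<^sub>R e) (\<delta> * t)"
    then have y: "norm (y - (z - t *\<^sub>R e)) < \<delta> * t"
      by (simp add: dist_norm norm_minus_commute)
    have \<delta>t: "\<delta> * t \<le> t" using \<delta> t by simp
    have "norm (y - z) \<le> norm (y - (z - t *\<^sub>R e)) + t"
      using norm_triangle_ineq4[of "y - (z - t *\<^sub>R e)" "t *\<^sub>R e"] e t by simp
    then have "norm (y - z) < 2 * t"
      using y \<delta>t by linarith
    then have yz: "dist z y < 2 * t"
      by (simp add: dist_norm norm_minus_commute)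
    then have y_ball: "y \<in> ball z0 r"
      using z t r dist_triangle[of z0 y z] by simp
    have "z \<notin> \<Omega>" using z(1) assms(1) by (simp add: frontier_def interior_open)
    then have z_low: "z \<bullet> e \<le> \<gamma> (P z)"
      using graph z r by (force simp: P_def)
    have "P (z - t *\<^sub>R e) = P z"
      by (simp add: P_def inner_diff_left ee algebra_simps)
    then have "dist (\<gamma> (P y)) (\<gamma> (P z)) \<le> L * norm (y - (z - t *\<^sub>R e))"
      using lipschitz_onD[OF L, of "P y" "P z"] P_contr[of y "z - t *\<^sub>R e"] P_orth L0
      by (simp add: dist_norm) (meson mult_left_mono order_trans)
    also have "\<dots> \<le> L * (\<delta> * t)" using y L0 by (intro mult_left_mono) auto
    finally have g: "\<gamma> (P z) - L * (\<delta> * t) \<le> \<gamma> (P y)" by (simp add: dist_real_def)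
    have "(y - (z - t *\<^sub>R e)) \<bullet> e \<le> norm (y - (z - t *\<^sub>R e))"
      using norm_cauchy_schwarz[of "y - (z - t *\<^sub>R e)" e] e by simp
    then have "y \<bullet> e \<le> z \<bullet> e - t + \<delta> * t"
      using y by (simp add: inner_diff_left ee)
    moreover have "\<delta> * t + L * (\<delta> * t) = t"
      using \<delta>(3) by (metis distrib_right mult.assoc mult_1)
    ultimately have "y \<bullet> e \<le> \<gamma> (P y)" using g z_low by linarith
    then have "y \<notin> \<Omega>" using graph y_ball by (force simp: P_def)
    then show "y \<in> ball z (2 * t) - \<Omega>" using yz by simp
  qed
  then show ?thesis using r \<delta>(1)
    by (intro exI[of _ "r/4"] conjI exI[of _ \<delta>]) auto
qed

text \<open>The constants of finitely many charts cover the compact boundary, and the property is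
  preserved when \<open>\<delta>\<close> and the range of \<open>t\<close> shrink.\<close>

lemma lipschitz_boundary_exterior_ball:
  fixes \<Omega> :: "'a::euclidean_space set"
  assumes "open \<Omega>" "bounded \<Omega>" "lipschitz_boundary \<Omega>"
  obtains \<delta> \<tau> where "0 < \<delta>" "0 < \<tau>"
    "\<And>z t. z \<in> frontier \<Omega> \<Longrightarrow> 0 < t \<Longrightarrow> t \<le> \<tau> \<Longrightarrow> \<exists>w. ball w (\<delta> * t) \<subseteq> ball z (2 * t) - \<Omega>"
proof -
  obtain T D where TD: "\<And>z0. z0 \<in> frontier \<Omega> \<Longrightarrow> 0 < T z0" "\<And>z0. z0 \<in> frontier \<Omega> \<Longrightarrow> 0 < D z0"
    and loc: "\<And>z0 z t. z0 \<in> frontier \<Omega> \<Longrightarrow> z \<in> frontier \<Omega> \<inter> ball z0 (T z0) \<Longrightarrow> 0 < t \<Longrightarrow> t \<le> T z0 \<Longrightarrow>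
      \<exists>w. ball w (D z0 * t) \<subseteq> ball z (2 * t) - \<Omega>"
    using lipschitz_boundary_exterior_ball_local[OF assms(1,3)] by metis
  have "compact (frontier \<Omega>)" using assms(2) by (rule compact_frontier_bounded)
  then obtain F where F: "F \<subseteq> frontier \<Omega>" "finite F" "frontier \<Omega> \<subseteq> (\<Union>z0\<in>F. ball z0 (T z0))"
    by (rule compactE_image[where C = "frontier \<Omega>" and f = "\<lambda>z0. ball z0 (T z0)"])
      (use TD in \<open>auto intro!: bexI\<close>)
  define \<delta> where "\<delta> = Min (insert 1 (D ` F))"
  define \<tau> where "\<tau> = Min (insert 1 (T ` F))"
  show thesis
  proof (rule that[of \<delta> \<tau>])
    show "0 < \<delta>" "0 < \<tau>" using F TD by (auto simp: \<delta>_def \<tau>_def)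
    fix z t assume z: "z \<in> frontier \<Omega>" and t: "0 < t" "t \<le> \<tau>"
    obtain z0 where z0: "z0 \<in> F" "z \<in> ball z0 (T z0)" using F z by auto
    have "\<tau> \<le> T z0" "\<delta> \<le> D z0" using z0 F by (auto simp: \<delta>_def \<tau>_def)
    moreover obtain w where "ball w (D z0 * t) \<subseteq> ball z (2 * t) - \<Omega>"
      using loc[of z0 z t] z0 z F t calculation by auto
    moreover have "ball w (\<delta> * t) \<subseteq> ball w (D z0 * t)"
      using calculation t by (intro subset_ball mult_right_mono) auto
    ultimately show "\<exists>w. ball w (\<delta> * t) \<subseteq> ball z (2 * t) - \<Omega>" by blast
  qed
qed

definition hardy_weight :: "real \<Rightarrow> real \<Rightarrow> real" where
  "hardy_weight q d = max 0 (ln (1 / d)) / d powr q"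

text \<open>With \<open>z\<close> the nearest boundary point and \<open>d = \<bar>x - z\<bar>\<close>, an exterior ball of radius \<open>\<delta> d\<close>
  lies within \<open>2 d\<close> of \<open>z\<close>, so within \<open>3 d\<close> of \<open>x\<close>. Its volume is of order \<open>d\<^sup>N\<close>, which
  cancels the dimensional part of the singularity and leaves \<open>ln (1/(3 d)) / d\<^sup>s\<^sup>p\<close>. The bound
  \<open>d \<le> 1/9\<close> means \<open>3 d \<le> \<surd>d\<close>, which costs only a factor two in the logarithm.\<close>

lemma hardy_weight_le_exterior_kernel_mass:
  fixes \<Omega> :: "'a::euclidean_space set"
  assumes p: "0 < p" "0 < s" "s < 1"
    and \<Omega>: "open \<Omega>" "bounded \<Omega>" "\<Omega> \<noteq> {}" "lipschitz_boundary \<Omega>"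
  obtains C d0 where "0 < C" "0 < d0" "d0 \<le> 1"
    "\<And>x. x \<in> \<Omega> \<Longrightarrow> infdist x (frontier \<Omega>) \<le> d0 \<Longrightarrow>
      ennreal (hardy_weight (s * p) (infdist x (frontier \<Omega>)))
        \<le> ennreal C * (\<integral>\<^sup>+ y. indicator (- \<Omega>) y * ennreal (log_kernel s p (x - y)) \<partial>lborel)"
proof -
  obtain \<delta> \<tau> where \<delta>: "0 < \<delta>" and \<tau>: "0 < \<tau>"
    and ext: "\<And>z t. z \<in> frontier \<Omega> \<Longrightarrow> 0 < t \<Longrightarrow> t \<le> \<tau> \<Longrightarrow> \<exists>w. ball w (\<delta> * t) \<subseteq> ball z (2 * t) - \<Omega>"
    using lipschitz_boundary_exterior_ball[OF \<Omega>(1,2,4)] by metis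
  define N where "N = real DIM('a)"
  define K where "K = kernel_const DIM('a) s p"
  define V where "V = unit_ball_vol N * \<delta> ^ DIM('a)"
  have K: "0 < K" unfolding K_def by (rule kernel_const_pos[OF p])
  have V: "0 < V" using \<delta> by (auto simp: V_def N_def)
  define C where "C = 2 * 3 powr (N + s * p) / (K * V)"
  have C: "0 < C" using K V by (simp add: C_def)
  have F: "closed (frontier \<Omega>)" "frontier \<Omega> \<noteq> {}"
    using \<Omega> by (auto simp: frontier_eq_empty)
  show thesis
  proof (rule that[of C "min \<tau> (1/9)"])
    fix x assume x: "x \<in> \<Omega>" "infdist x (frontier \<Omega>) \<le> min \<tau> (1/9)"
    define d where "d = infdist x (frontier \<Omega>)"
    have "x \<notin> frontier \<Omega>" using x \<Omega> by (simp add: frontier_def interior_open)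
    then have d0: "0 < d" unfolding d_def using F by (intro infdist_pos_not_in_closed) auto
    have d: "d \<le> \<tau>" "d \<le> 1/9" using x by (auto simp: d_def)
    obtain z where z: "z \<in> frontier \<Omega>" "d = dist x z"
      using infdist_attains_inf[OF F] unfolding d_def by metis
    obtain w where w: "ball w (\<delta> * d) \<subseteq> ball z (2 * d) - \<Omega>"
      using ext[OF z(1) d0 d(1)] by blast
    define c where "c = K * max 0 (- ln (3 * d)) / (3 * d) powr (N + s * p)"
    have c0: "0 \<le> c" using K by (simp add: c_def)
    have "ln (9 * d) \<le> 0" using d d0 by simp
    moreover have "ln (9 * d) = 2 * ln 3 + ln d" "ln (3 * d) = ln 3 + ln d"
      using d0 ln_realpow[of 3 2] by (auto simp: ln_mult)
    moreover have "0 < ln (3 :: real)" by simp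
    moreover have "ln (1 / d) = - ln d" using d0 by (simp add: ln_div)
    ultimately have "ln (1 / d) \<le> 2 * (- ln (3 * d))" by linarith
    then have ln_half: "max 0 (ln (1 / d)) \<le> 2 * max 0 (- ln (3 * d))"
      using max.cobounded1[of 0 "- ln (3 * d)"] max.cobounded2[of "- ln (3 * d)" 0]
      by (intro max.boundedI) linarith+
    have pw: "(3 * d) powr (N + s * p) = 3 powr (N + s * p) * d ^ DIM('a) * d powr (s * p)"
      using d0 by (simp add: powr_mult powr_add N_def powr_realpow)
    have "hardy_weight (s * p) d \<le> 2 * max 0 (- ln (3 * d)) / d powr (s * p)"
      unfolding hardy_weight_def using ln_half by (intro divide_right_mono) auto
    also have "\<dots> = C * (c * (V * d ^ DIM('a)))"
      unfolding C_def c_def pw using K V d0 by (simp add: field_simps)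
    finally have "ennreal (hardy_weight (s * p) d) \<le> ennreal C * (ennreal c * ennreal (V * d ^ DIM('a)))"
      using C c0 V d0 by (simp flip: ennreal_mult' add: ennreal_leI)
    also have "ennreal c * ennreal (V * d ^ DIM('a)) = (\<integral>\<^sup>+ y. ennreal c * indicator (ball w (\<delta> * d)) y \<partial>lborel)"
      using \<delta> d0 by (subst nn_integral_cmult_indicator)
        (auto simp: emeasure_ball V_def N_def power_mult_distrib mult_ac)
    also have "\<dots> \<le> (\<integral>\<^sup>+ y. indicator (- \<Omega>) y * ennreal (log_kernel s p (x - y)) \<partial>lborel)"
    proof (rule nn_integral_mono)
      fix y
      show "ennreal c * indicator (ball w (\<delta> * d)) y \<le> indicator (- \<Omega>) y * ennreal (log_kernel s p (x - y))"
      proof (cases "y \<in> ball w (\<delta> * d)")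
        case True
        then have y: "y \<notin> \<Omega>" "dist z y < 2 * d" using w by auto
        have "norm (x - y) \<le> 3 * d" using y z dist_triangle[of x y z] by (simp add: dist_norm)
        moreover have "x - y \<noteq> 0" using x y by auto
        ultimately have "c \<le> log_kernel s p (x - y)"
          unfolding c_def K_def N_def by (intro log_kernel_ge[OF p]) auto
        then show ?thesis using True y by (simp add: ennreal_leI)
      qed simp
    qed
    finally show "ennreal (hardy_weight (s * p) (infdist x (frontier \<Omega>)))
        \<le> ennreal C * (\<integral>\<^sup>+ y. indicator (- \<Omega>) y * ennreal (log_kernel s p (x - y)) \<partial>lborel)"
      by (simp add: d_def mult_left_mono)
  qed (use C \<tau> in auto)
qed

section \<open>A Poincare inequality for the energy\<close>

lemma nn_integral_lborel_translation:
  fixes c :: "'a::euclidean_space"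
  assumes [measurable]: "f \<in> borel_measurable borel"
  shows "(\<integral>\<^sup>+ x. f (c + x) \<partial>lborel) = (\<integral>\<^sup>+ x. f x \<partial>lborel)"
proof -
  have "(\<integral>\<^sup>+ x. f x \<partial>lborel) = (\<integral>\<^sup>+ x. f x \<partial>distr lborel borel ((+) c))"
    by (simp add: lborel_distr_plus)
  also have "\<dots> = (\<integral>\<^sup>+ x. f (c + x) \<partial>lborel)"
    by (subst nn_integral_distr) auto
  finally show ?thesis by simp
qed

lemma abs_telescope_powr_le:
  fixes a :: "nat \<Rightarrow> real"
  assumes "0 < p"
  shows "\<bar>a 0 - a n\<bar> powr p \<le> real n powr p * (\<Sum>k<n. \<bar>a k - a (Suc k)\<bar> powr p)"
proof (cases "n = 0")
  case False
  define M where "M = Max ((\<lambda>k. \<bar>a k - a (Suc k)\<bar>) ` {..<n})"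
  have "M \<in> (\<lambda>k. \<bar>a k - a (Suc k)\<bar>) ` {..<n}"
    unfolding M_def using False by (intro Max_in) auto
  then obtain j where j: "j < n" "M = \<bar>a j - a (Suc j)\<bar>" by auto
  have "\<bar>a 0 - a n\<bar> = \<bar>\<Sum>k<n. a k - a (Suc k)\<bar>"
    by (simp add: sum_lessThan_telescope')
  also have "\<dots> \<le> (\<Sum>k<n. \<bar>a k - a (Suc k)\<bar>)" by (rule sum_abs)
  also have "\<dots> \<le> (\<Sum>k<n. M)"
    unfolding M_def by (intro sum_mono Max_ge) auto
  finally have "\<bar>a 0 - a n\<bar> powr p \<le> (real n * M) powr p"
    using assms by (intro powr_mono2) auto
  also have "\<dots> = real n powr p * M powr p"
    using j by (simp add: powr_mult)
  also have "M powr p \<le> (\<Sum>k<n. \<bar>a k - a (Suc k)\<bar> powr p)"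
    unfolding j(2) using j(1) by (intro member_le_sum) auto
  finally show ?thesis by (simp add: mult_left_mono)
qed simp

text \<open>For \<open>x\<close> in the ball, \<open>x + n h\<close> is outside it, so \<open>v x\<close> is the sum of the \<open>n\<close> increments
  along the chain \<open>x, x + h, \<dots>, x + n h\<close>; all of these have the same \<open>L\<^sup>p\<close> norm.\<close>

lemma nn_integral_powr_le_translate:
  fixes v :: "'a::euclidean_space \<Rightarrow> real"
  assumes "0 < p" and [measurable]: "v \<in> borel_measurable borel"
    and zero: "\<And>x. x \<notin> ball 0 R \<Longrightarrow> v x = 0" and h: "2 * R \<le> real n * norm h"
  shows "(\<integral>\<^sup>+ x. ennreal (\<bar>v x\<bar> powr p) \<partial>lborel)
    \<le> ennreal (real n powr p * real n) * (\<integral>\<^sup>+ x. ennreal (\<bar>v x - v (x + h)\<bar> powr p) \<partial>lborel)"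
proof -
  define f where "f x = ennreal (\<bar>v x - v (x + h)\<bar> powr p)" for x
  have [measurable]: "f \<in> borel_measurable borel" unfolding f_def [abs_def] by measurable
  have "(\<integral>\<^sup>+ x. ennreal (\<bar>v x\<bar> powr p) \<partial>lborel)
    \<le> (\<integral>\<^sup>+ x. ennreal (real n powr p) * (\<Sum>k<n. f (real k *\<^sub>R h + x)) \<partial>lborel)"
  proof (rule nn_integral_mono)
    fix x
    show "ennreal (\<bar>v x\<bar> powr p) \<le> ennreal (real n powr p) * (\<Sum>k<n. f (real k *\<^sub>R h + x))"
    proof (cases "x \<in> ball 0 R")
      case True
      have "real n * norm h \<le> norm (real n *\<^sub>R h + x) + norm x"
        using norm_triangle_ineq4[of "real n *\<^sub>R h + x" x] by simp
      then have "v (real n *\<^sub>R h + x) = 0" using True h by (intro zero) auto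
      then have "\<bar>v x\<bar> powr p \<le> real n powr p *
          (\<Sum>k<n. \<bar>v (real k *\<^sub>R h + x) - v (real k *\<^sub>R h + x + h)\<bar> powr p)"
        using abs_telescope_powr_le[OF assms(1), of "\<lambda>k. v (real k *\<^sub>R h + x)" n]
        by (simp add: algebra_simps)
      then have "ennreal (\<bar>v x\<bar> powr p) \<le> ennreal (real n powr p *
          (\<Sum>k<n. \<bar>v (real k *\<^sub>R h + x) - v (real k *\<^sub>R h + x + h)\<bar> powr p))"
        by (rule ennreal_leI)
      then show ?thesis
        by (simp add: f_def ennreal_mult sum_nonneg flip: sum_ennreal)
    qed (use zero assms(1) in simp)
  qed
  also have "\<dots> = ennreal (real n powr p) * (\<Sum>k<n. \<integral>\<^sup>+ x. f (real k *\<^sub>R h + x) \<partial>lborel)"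
    by (subst nn_integral_cmult, measurable) (subst nn_integral_sum, auto)
  also have "\<dots> = ennreal (real n powr p) * (\<Sum>k<n. \<integral>\<^sup>+ x. f x \<partial>lborel)"
    by (subst nn_integral_lborel_translation) auto
  also have "\<dots> = ennreal (real n powr p * real n) * (\<integral>\<^sup>+ x. f x \<partial>lborel)"
    by (simp add: ennreal_mult' mult.assoc ennreal_of_nat_eq_real_of_nat)
  finally show ?thesis by (simp add: f_def)
qed

lemma borel_energy_translation_form:
  fixes v :: "'a::euclidean_space \<Rightarrow> real"
  assumes [measurable]: "v \<in> borel_measurable borel"
  shows "borel_energy s p v =
    (\<integral>\<^sup>+ h. \<integral>\<^sup>+ x. ennreal (\<bar>v x - v (x + h)\<bar> powr p * log_kernel s p h) \<partial>lborel \<partial>lborel)"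
proof -
  have "borel_energy s p v =
    (\<integral>\<^sup>+ x. \<integral>\<^sup>+ h. ennreal (\<bar>v x - v (x + h)\<bar> powr p * log_kernel s p (x - (x + h))) \<partial>lborel \<partial>lborel)"
    unfolding borel_energy_def
    by (intro nn_integral_cong nn_integral_lborel_translation[symmetric]) measurable
  also have "\<dots> = (\<integral>\<^sup>+ x. \<integral>\<^sup>+ h. ennreal (\<bar>v x - v (x + h)\<bar> powr p * log_kernel s p h) \<partial>lborel \<partial>lborel)"
    by (simp add: log_kernel_minus)
  also have "\<dots> = (\<integral>\<^sup>+ h. \<integral>\<^sup>+ x. ennreal (\<bar>v x - v (x + h)\<bar> powr p * log_kernel s p h) \<partial>lborel \<partial>lborel)"
    by (rule lborel_pair.Fubini'[symmetric]) measurable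
  finally show ?thesis .
qed

text \<open>The previous bound holds for every single jump \<open>h\<close> of length at least \<open>1/4\<close>, with one \<open>n\<close>.
  Integrating it against \<open>k h dh\<close> over a ball of jumps on which \<open>k\<close> is bounded below gives the
  energy on the right.\<close>

lemma borel_energy_poincare:
  fixes \<Omega> :: "'a::euclidean_space set"
  assumes p: "0 < p" "0 < s" "s < 1" and "bounded \<Omega>"
  obtains C where "0 < C"
    "\<And>v. v \<in> borel_measurable borel \<Longrightarrow> (\<And>x. x \<notin> \<Omega> \<Longrightarrow> v x = 0) \<Longrightarrow>
      (\<integral>\<^sup>+ x. ennreal (\<bar>v x\<bar> powr p) \<partial>lborel) \<le> ennreal C * borel_energy s p v"
proof -
  obtain R where R: "0 < R" "\<Omega> \<subseteq> ball 0 R"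
    using bounded_subset_ballD[OF \<open>bounded \<Omega>\<close>] by metis
  obtain n :: nat where n: "8 * R \<le> real n" using real_arch_simple by blast
  have n0: "0 < real n" using n R by linarith
  \<comment> \<open>A ball in the shell \<open>1/4 \<le> \<bar>h\<bar> \<le> 1/2\<close>: jumps bounded away from zero, so that \<open>n\<close> is uniform,
    and from one, where the kernel vanishes.\<close>
  obtain b :: 'a where b: "norm b = 1" using nonempty_Basis norm_Basis by blast
  define B where "B = ball ((3/8) *\<^sub>R b) (1/8 :: real)"
  have B: "1/4 \<le> norm h" "norm h \<le> 1/2" if "h \<in> B" for h
  proof -
    have "norm ((3/8) *\<^sub>R b - h) < 1/8" using that by (simp add: B_def dist_norm)
    moreover have "norm ((3/8) *\<^sub>R b) = 3/8" using b by simp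
    ultimately show "1/4 \<le> norm h" "norm h \<le> 1/2"
      using norm_triangle_ineq3[of "(3/8) *\<^sub>R b" h] by auto
  qed
  define \<kappa> where "\<kappa> = kernel_const DIM('a) s p * max 0 (- ln (1/2)) / (1/2) powr (real DIM('a) + s * p)"
  have \<kappa>: "0 < \<kappa>" using kernel_const_pos[OF p, of "DIM('a)"] by (simp add: \<kappa>_def ln_div)
  define m where "m = measure lborel B"
  have m: "0 < m" by (simp add: m_def B_def)
  have B_m: "emeasure lborel B = ennreal m"
    unfolding m_def using emeasure_lborel_ball_finite[of "(3/8) *\<^sub>R b" "1/8"]
    by (intro emeasure_eq_ennreal_measure) (auto simp: B_def)
  define c where "c = real n powr p * real n"
  have c: "0 < c" using n0 by (simp add: c_def)
  show thesis
  proof (rule that[of "c / (\<kappa> * m)"])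
    show "0 < c / (\<kappa> * m)" using c \<kappa> m by simp
    fix v :: "'a \<Rightarrow> real"
    assume v [measurable]: "v \<in> borel_measurable borel" and zero: "\<And>x. x \<notin> \<Omega> \<Longrightarrow> v x = 0"
    define I where "I = (\<integral>\<^sup>+ x. ennreal (\<bar>v x\<bar> powr p) \<partial>lborel)"
    have "ennreal (\<kappa> * m) * I = (\<integral>\<^sup>+ h. (ennreal \<kappa> * I) * indicator B h \<partial>lborel)"
      using \<kappa> m by (subst nn_integral_cmult_indicator) (auto simp: B_m[unfolded B_def] B_def ennreal_mult mult_ac)
    also have "\<dots> \<le> (\<integral>\<^sup>+ h. ennreal c *
        (\<integral>\<^sup>+ x. ennreal (\<bar>v x - v (x + h)\<bar> powr p * log_kernel s p h) \<partial>lborel) \<partial>lborel)"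
    proof (rule nn_integral_mono)
      fix h
      show "(ennreal \<kappa> * I) * indicator B h \<le> ennreal c *
        (\<integral>\<^sup>+ x. ennreal (\<bar>v x - v (x + h)\<bar> powr p * log_kernel s p h) \<partial>lborel)"
      proof (cases "h \<in> B")
        case True
        have "2 * R \<le> real n * norm h"
          using n n0 B(1)[OF True] mult_left_mono[of "1/4" "norm h" "real n"] by linarith
        then have I: "I \<le> ennreal c * (\<integral>\<^sup>+ x. ennreal (\<bar>v x - v (x + h)\<bar> powr p) \<partial>lborel)"
          unfolding I_def c_def
          by (intro nn_integral_powr_le_translate[OF p(1) v, where R = R]) (use R zero in blast)+
        have k: "\<kappa> \<le> log_kernel s p h"
          unfolding \<kappa>_def using B[OF True] by (intro log_kernel_ge p) auto
        have "ennreal \<kappa> * I \<le> ennreal (log_kernel s p h) *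
            (ennreal c * (\<integral>\<^sup>+ x. ennreal (\<bar>v x - v (x + h)\<bar> powr p) \<partial>lborel))"
          using I k by (intro mult_mono) (auto simp: ennreal_leI)
        also have "\<dots> = ennreal c *
            (\<integral>\<^sup>+ x. ennreal (log_kernel s p h) * ennreal (\<bar>v x - v (x + h)\<bar> powr p) \<partial>lborel)"
          by (subst nn_integral_cmult) (auto simp: mult_ac)
        finally show ?thesis
          using True log_kernel_nonneg[OF p, of h] by (simp add: ennreal_mult mult_ac)
      qed simp
    qed
    also have "\<dots> = ennreal c * borel_energy s p v"
      unfolding borel_energy_translation_form[OF v] by (rule nn_integral_cmult) measurable
    finally have "ennreal (1 / (\<kappa> * m)) * (ennreal (\<kappa> * m) * I)
        \<le> ennreal (1 / (\<kappa> * m)) * (ennreal c * borel_energy s p v)"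
      by (rule mult_left_mono) simp
    then show "(\<integral>\<^sup>+ x. ennreal (\<bar>v x\<bar> powr p) \<partial>lborel) \<le> ennreal (c / (\<kappa> * m)) * borel_energy s p v"
      using \<kappa> m c by (simp add: I_def flip: mult.assoc ennreal_mult')
  qed
qed

section \<open>The Hardy inequality\<close>

text \<open>Points closer to the boundary than \<open>d0\<close> are paid for by the interaction with the exterior;
  at the others the weight, which decreases in \<open>d\<close>, is at most its value at \<open>d0\<close>, and the
  Poincare inequality applies.\<close>

lemma borel_hardy_inequality:
  fixes \<Omega> :: "'a::euclidean_space set"
  assumes p: "0 < p" "0 < s" "s < 1"
    and \<Omega>: "open \<Omega>" "bounded \<Omega>" "\<Omega> \<noteq> {}" "lipschitz_boundary \<Omega>"
  obtains C where "0 < C"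
    "\<And>v. v \<in> borel_measurable borel \<Longrightarrow> (\<And>x. x \<notin> \<Omega> \<Longrightarrow> v x = 0) \<Longrightarrow>
      (\<integral>\<^sup>+ x\<in>\<Omega>. ennreal (\<bar>v x\<bar> powr p * hardy_weight (s * p) (infdist x (frontier \<Omega>))) \<partial>lborel)
        \<le> ennreal C * borel_energy s p v"
proof -
  obtain C1 d0 where C1: "0 < C1" and d0: "0 < d0" "d0 \<le> 1"
    and near: "\<And>x. x \<in> \<Omega> \<Longrightarrow> infdist x (frontier \<Omega>) \<le> d0 \<Longrightarrow>
      ennreal (hardy_weight (s * p) (infdist x (frontier \<Omega>)))
        \<le> ennreal C1 * (\<integral>\<^sup>+ y. indicator (- \<Omega>) y * ennreal (log_kernel s p (x - y)) \<partial>lborel)"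
    using hardy_weight_le_exterior_kernel_mass[OF assms] by metis
  obtain C2 where C2: "0 < C2" and poincare: "\<And>v. v \<in> borel_measurable borel \<Longrightarrow> (\<And>x. x \<notin> \<Omega> \<Longrightarrow> v x = 0) \<Longrightarrow>
      (\<integral>\<^sup>+ x. ennreal (\<bar>v x\<bar> powr p) \<partial>lborel) \<le> ennreal C2 * borel_energy s p v"
    using borel_energy_poincare[OF p \<Omega>(2)] by metis
  define W where "W = hardy_weight (s * p) d0"
  have W: "0 \<le> W" by (simp add: W_def hardy_weight_def)
  have far: "hardy_weight (s * p) d \<le> W" if "d0 \<le> d" for d
    unfolding W_def hardy_weight_def using that d0 p
    by (intro frac_le max.mono powr_mono2) (auto simp: ln_div)
  show thesis
  proof (rule that[of "C1 + W * C2"])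
    show "0 < C1 + W * C2" using C1 C2 W by (simp add: add_pos_nonneg)
    fix v :: "'a \<Rightarrow> real"
    assume v [measurable]: "v \<in> borel_measurable borel" and zero: "\<And>x. x \<notin> \<Omega> \<Longrightarrow> v x = 0"
    define e where "e x = (\<integral>\<^sup>+ y. ennreal (\<bar>v x - v y\<bar> powr p * log_kernel s p (x - y)) \<partial>lborel)" for x
    have [measurable]: "e \<in> borel_measurable borel" unfolding e_def [abs_def] by measurable
    have [measurable]: "\<Omega> \<in> sets borel" using \<Omega>(1) by simp
    have exterior: "ennreal (\<bar>v x\<bar> powr p) * (\<integral>\<^sup>+ y. indicator (- \<Omega>) y * ennreal (log_kernel s p (x - y)) \<partial>lborel) \<le> e x" for x
    proof -
      have "ennreal (\<bar>v x\<bar> powr p) * (\<integral>\<^sup>+ y. indicator (- \<Omega>) y * ennreal (log_kernel s p (x - y)) \<partial>lborel)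
        = (\<integral>\<^sup>+ y. ennreal (\<bar>v x\<bar> powr p) * (indicator (- \<Omega>) y * ennreal (log_kernel s p (x - y))) \<partial>lborel)"
        by (rule nn_integral_cmult[symmetric]) measurable
      also have "\<dots> \<le> e x"
        unfolding e_def
        by (intro nn_integral_mono) (auto simp: indicator_def zero ennreal_mult log_kernel_nonneg[OF p])
      finally show ?thesis .
    qed
    have "(\<integral>\<^sup>+ x\<in>\<Omega>. ennreal (\<bar>v x\<bar> powr p * hardy_weight (s * p) (infdist x (frontier \<Omega>))) \<partial>lborel)
      \<le> (\<integral>\<^sup>+ x. ennreal C1 * e x + ennreal W * ennreal (\<bar>v x\<bar> powr p) \<partial>lborel)"
    proof (rule nn_integral_mono)
      fix x
      let ?d = "infdist x (frontier \<Omega>)"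
      have eq: "ennreal (\<bar>v x\<bar> powr p * hardy_weight (s * p) ?d) =
          ennreal (\<bar>v x\<bar> powr p) * ennreal (hardy_weight (s * p) ?d)"
        by (rule ennreal_mult') simp
      show "ennreal (\<bar>v x\<bar> powr p * hardy_weight (s * p) ?d) * indicator \<Omega> x
        \<le> ennreal C1 * e x + ennreal W * ennreal (\<bar>v x\<bar> powr p)"
      proof (cases "x \<in> \<Omega>")
        case True
        show ?thesis
        proof (cases "?d \<le> d0")
          case near_x: True
          have "ennreal (\<bar>v x\<bar> powr p) * ennreal (hardy_weight (s * p) ?d)
            \<le> ennreal (\<bar>v x\<bar> powr p) * (ennreal C1 * (\<integral>\<^sup>+ y. indicator (- \<Omega>) y * ennreal (log_kernel s p (x - y)) \<partial>lborel))"
            by (intro mult_left_mono near True near_x) simp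
          also have "\<dots> \<le> ennreal C1 * e x"
            using mult_left_mono[OF exterior, of "ennreal C1" x] by (simp add: mult_ac)
          finally show ?thesis
            using True by (simp add: eq add_increasing2)
        next
          case False
          then have "ennreal (\<bar>v x\<bar> powr p) * ennreal (hardy_weight (s * p) ?d)
            \<le> ennreal W * ennreal (\<bar>v x\<bar> powr p)"
            using far[of ?d] by (subst mult.commute) (auto intro!: mult_right_mono ennreal_leI)
          then show ?thesis using True by (simp add: eq add_increasing)
        qed
      qed simp
    qed
    also have "\<dots> = ennreal C1 * borel_energy s p v + ennreal W * (\<integral>\<^sup>+ x. ennreal (\<bar>v x\<bar> powr p) \<partial>lborel)"
      by (simp add: nn_integral_add nn_integral_cmult borel_energy_def e_def)
    also have "\<dots> \<le> ennreal C1 * borel_energy s p v + ennreal W * (ennreal C2 * borel_energy s p v)"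
      by (intro add_left_mono mult_left_mono poincare v zero) auto
    also have "\<dots> = ennreal (C1 + W * C2) * borel_energy s p v"
      using C1 C2 W by (simp add: ennreal_plus ennreal_mult distrib_right mult.assoc)
    finally show "(\<integral>\<^sup>+ x\<in>\<Omega>. ennreal (\<bar>v x\<bar> powr p * hardy_weight (s * p) (infdist x (frontier \<Omega>))) \<partial>lborel)
        \<le> ennreal (C1 + W * C2) * borel_energy s p v" .
  qed
qed

theorem theorem3p3:
  fixes s p :: real and \<Omega> :: "'a::euclidean_space set"
  assumes "1 < p" and "0 < s" and "s < 1"
    and "bounded_lipschitz_domain \<Omega>"
  shows "\<exists>C::real. C > 0 \<and>
    (\<forall>u \<in> log_sobolev0 s p \<Omega>.
      (\<integral>\<^sup>+ x \<in> \<Omega>. ennreal (\<bar>u x\<bar> powr p / infdist x (frontier \<Omega>) powr (s * p)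
            * max 0 (ln (1 / infdist x (frontier \<Omega>)))) \<partial>lebesgue)
        \<le> ennreal C * log_energy s p u)"
proof -
  have \<Omega>: "open \<Omega>" "bounded \<Omega>" "\<Omega> \<noteq> {}" "lipschitz_boundary \<Omega>"
    using assms(4) by (auto simp: bounded_lipschitz_domain_def)
  obtain C where C: "0 < C" and hardy:
    "\<And>v. v \<in> borel_measurable borel \<Longrightarrow> (\<And>x. x \<notin> \<Omega> \<Longrightarrow> v x = 0) \<Longrightarrow>
      (\<integral>\<^sup>+ x\<in>\<Omega>. ennreal (\<bar>v x\<bar> powr p * hardy_weight (s * p) (infdist x (frontier \<Omega>))) \<partial>lborel)
        \<le> ennreal C * borel_energy s p v"
    by (rule borel_hardy_inequality[OF _ assms(2,3) \<Omega>]) (use assms(1) in auto)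
  show ?thesis
  proof (intro exI conjI ballI)
    show "0 < C" by (rule C)
    fix u assume "u \<in> log_sobolev0 s p \<Omega>"
    then have u: "u \<in> borel_measurable lebesgue" and u0: "AE x in lborel. x \<notin> \<Omega> \<longrightarrow> u x = 0"
      by (auto simp: log_sobolev0_def AE_completion_iff)
    obtain g where g [measurable]: "g \<in> borel_measurable borel" and ug: "AE x in lborel. u x = g x"
      using completion_ex_borel_measurable_real[OF u] by auto
    define v where "v x = indicator \<Omega> x * g x" for x
    have [measurable]: "\<Omega> \<in> sets borel" using \<Omega>(1) by simp
    have v: "v \<in> borel_measurable borel" unfolding v_def [abs_def] by measurable
    have uv: "AE x in lborel. u x = v x"
      using u0 ug by eventually_elim (auto simp: v_def indicator_def)
    have "(\<integral>\<^sup>+ x \<in> \<Omega>. ennreal (\<bar>u x\<bar> powr p / infdist x (frontier \<Omega>) powr (s * p)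
            * max 0 (ln (1 / infdist x (frontier \<Omega>)))) \<partial>lebesgue)
      = (\<integral>\<^sup>+ x\<in>\<Omega>. ennreal (\<bar>v x\<bar> powr p * hardy_weight (s * p) (infdist x (frontier \<Omega>))) \<partial>lborel)"
      unfolding nn_integral_completion using uv
      by (intro nn_integral_cong_AE) (auto elim!: eventually_mono simp: hardy_weight_def)
    also have "\<dots> \<le> ennreal C * borel_energy s p v"
      by (intro hardy v) (simp add: v_def)
    also have "borel_energy s p v = log_energy s p u"
      by (rule log_energy_eq_borel_energy[OF u uv, symmetric])
    finally show "(\<integral>\<^sup>+ x \<in> \<Omega>. ennreal (\<bar>u x\<bar> powr p / infdist x (frontier \<Omega>) powr (s * p)
            * max 0 (ln (1 / infdist x (frontier \<Omega>)))) \<partial>lebesgue)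
        \<le> ennreal C * log_energy s p u" .
  qed
qed

end
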